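(* Let $\mathcal{F}=\{\mathbb{X};\,f_1,\dots,f_N\}$ be an iterated function system with point-fibred attractor $A$ on a complete metric space $\mathbb{X}$ such that $A^\circ\neq\varnothing$. (a) If $\mathcal{F}$ is contractive, then $\pi(\widehat{\mathbb{I}})=\mathbb{X}$ and $\pi\circ\sigma_n=f_n\circ\pi$ on $\widehat{\mathbb{I}}$ (with $\sigma_n:\widehat{\mathbb{I}}\to\widehat{\mathbb{I}}$, $f_n:\mathbb{X}\to\mathbb{X}$) for all $n\in I_-$. (b) If $\mathbb{X}$ is compact and the dual repeller $A^*$ is a point-fibred attractor of $\mathcal{F}^*$ with $(A^* )^\circ\neq\varnothing$, then $\pi(\widehat{\mathbb{I}})=\pi^*(\widehat{\mathbb{I}}^* )=\mathbb{X}$; moreover $\pi\circ\sigma_n=f_n\circ\pi$ on $\widehat{\mathbb{I}}$ for all $n\in I_-$, and $\pi^*\circ\sigma_n=f_n\circ\pi^*$ on $\widehat{\mathbb{I}}^*$ (with $\sigma_n:\widehat{\mathbb{I}}^*\to\widehat{\mathbb{I}}^*$) for all $n\in I_+$.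
   Context: An iterated function system (IFS) $\mathcal{F}=\{\mathbb{X};\,f_1,\dots,f_N\}$ is a complete metric space $(\mathbb{X},d_{\mathbb{X}})$ together with finitely many homeomorphisms $f_n:\mathbb{X}\to\mathbb{X}$ of $\mathbb{X}$ onto itself. It is contractive if there is $\lambda\in[0,1)$ with $d_{\mathbb{X}}(f_n(x),f_n(y))\leq\lambda d_{\mathbb{X}}(x,y)$ for all $n,x,y$. $H$ is the set of nonempty compact subsets of $\mathbb{X}$ with the Hausdorff metric. For $S\subset\mathbb{X}$, $F(S)=\bigcup_{n=1}^N f_n(S)$, and $F^k$ is the $k$-fold iterate of $F$. An attractor of $\mathcal{F}$ is a set $A\in H$ with $F(A)=A$ for which there is an open set $U\supset A$ such that $F^k(C)\to A$ in the Hausdorff metric for every $C\in H$ with $C\subset U$. The union of all such open sets $U$ is the basin $B(A)$ of $A$. The dual IFS is $\mathcal{F}^*=\{\mathbb{X};\,f_n^{-1},\ n=1,\dots,N\}$, and the dual repeller of $A$ is $A^*=\mathbb{X}\setminus B(A)$. $^\circ$ denotes interior in $\mathbb{X}$. $I_+=\{1,\dots,N\}$, $I_-=\{-1,\dots,-N\}$, $I=I_+\cup I_-$; $\mathbb{I}_+=I_+^\infty$, $\mathbb{I}_-=I_-^\infty$, $\mathbb{I}=\{\iota\in I^\infty:\iota_i\neq-\iota_{i+1}\text{ for all } i\}$ (infinite words indexed by $\mathbb{N}=\{1,2,\dots\}$). Let $$\widehat{\mathbb{I}}=\{\iota\in\mathbb{I}:\exists k\in\mathbb{N},\ \iota_j\in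 I_-\text{ for }j<k,\ \iota_j\in I_+\text{ for }j\geq k\},$$ $$\widehat{\mathbb{I}}^*=\{\iota\in\mathbb{I}:\exists k\in\mathbb{N},\ \iota_j\in I_+\text{ for }j<k,\ \iota_j\in I_-\text{ for }j\geq k\}.$$ For $n\in I$, $\sigma_n:\mathbb{I}\to\mathbb{I}$ is $\sigma_n(\iota_1\iota_2\cdots)=n\iota_1\iota_2\cdots$ if $\iota_1\neq-n$ and $=\iota_2\iota_3\cdots$ if $\iota_1=-n$. Set $f_{-n}=f_n^{-1}$ for $n\in I_+$ and $f_{\iota|k}=f_{\iota_1}\circ\cdots\circ f_{\iota_k}$. $A$ is point-fibred (w.r.t. $\mathcal{F}$) if for every $\iota\in\mathbb{I}_+$ the limit $\lim_{k\to\infty}f_{\iota|k}(C)$ exists in the Hausdorff metric for all $C\in H$ with $C\subset B(A)$, is a singleton subset of $A$, and is independent of $C$ (analogously for $A^*$ and $\mathcal{F}^*$, with $\iota\in\mathbb{I}_-$). The extended coding map is $\pi(\iota)=\lim_{k\to\infty}f_{\iota|k}(b)$ for $b\in B(A)$; it is well defined, independently of $b$, for all $\iota\in\mathbb{I}$ whose letters are eventually all in $I_+$, in particular on $\widehat{\mathbb{I}}$. Likewise $\pi^*(\iota)=\lim_{k\to\infty}f_{\iota|k}(b)$ with $b$ in the basin of $A^*$ w.r.t. $\mathcal{F}^*$, for $\iota\in\mathbb{I}$ whose letters are eventually all in $I_-$.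
   Formalization: In (b), the equality π(Î)=π*(Î* )=X is proved only when X does not have exactly two points; on a two-point space with all maps the identity, A={a} and A*={b}, it fails (π is constantly a). *)

theory Defs
  imports "HOL-Analysis.Analysis"
begin

text \<open>
  The complete metric space is the type \<open>'a\<close> (class \<^class>\<open>complete_space\<close>). An iterated function
  system is a pair \<open>N\<close>, \<open>f\<close>; only \<open>f 1, \<dots>, f N\<close> matter.
\<close>

definition ifs :: "nat \<Rightarrow> (nat \<Rightarrow> 'a::complete_space \<Rightarrow> 'a) \<Rightarrow> bool" where
  "ifs N f \<longleftrightarrow> N \<ge> 1 \<and> (\<forall>n\<in>{1..N}. \<exists>g. homeomorphism UNIV UNIV (f n) g)"

definition contractive :: "nat \<Rightarrow> (nat \<Rightarrow> 'a::metric_space \<Rightarrow> 'a) \<Rightarrow> bool" where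
  "contractive N f \<longleftrightarrow>
     (\<exists>c::real. 0 \<le> c \<and> c < 1 \<and> (\<forall>n\<in>{1..N}. \<forall>x y. dist (f n x) (f n y) \<le> c * dist x y))"

definition dual :: "(nat \<Rightarrow> 'a \<Rightarrow> 'a) \<Rightarrow> nat \<Rightarrow> 'a \<Rightarrow> 'a" where
  "dual f n = inv (f n)"

definition hyperspace :: "'a::metric_space set set" where
  "hyperspace = {C. compact C \<and> C \<noteq> {}}"

text \<open>The Hausdorff metric; meaningful on \<^const>\<open>hyperspace\<close>, where both suprema are attained.\<close>

definition hausdist :: "'a::metric_space set \<Rightarrow> 'a set \<Rightarrow> real" where
  "hausdist S T = max (SUP x\<in>S. infdist x T) (SUP y\<in>T. infdist y S)"

definition hausdorff_lim :: "(nat \<Rightarrow> 'a::metric_space set) \<Rightarrow> 'a set \<Rightarrow> bool" where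
  "hausdorff_lim S T \<longleftrightarrow> (\<lambda>k. hausdist (S k) T) \<longlonglongrightarrow> 0"

definition hutch :: "nat \<Rightarrow> (nat \<Rightarrow> 'a \<Rightarrow> 'a) \<Rightarrow> 'a set \<Rightarrow> 'a set" where
  "hutch N f S = (\<Union>n\<in>{1..N}. f n ` S)"

definition attracts :: "nat \<Rightarrow> (nat \<Rightarrow> 'a::metric_space \<Rightarrow> 'a) \<Rightarrow> 'a set \<Rightarrow> 'a set \<Rightarrow> bool" where
  "attracts N f A U \<longleftrightarrow> open U \<and> A \<subseteq> U \<and>
     (\<forall>C\<in>hyperspace. C \<subseteq> U \<longrightarrow> hausdorff_lim (\<lambda>k. (hutch N f ^^ k) C) A)"

definition attractor :: "nat \<Rightarrow> (nat \<Rightarrow> 'a::metric_space \<Rightarrow> 'a) \<Rightarrow> 'a set \<Rightarrow> bool" where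
  "attractor N f A \<longleftrightarrow> A \<in> hyperspace \<and> hutch N f A = A \<and> (\<exists>U. attracts N f A U)"

definition basin :: "nat \<Rightarrow> (nat \<Rightarrow> 'a::metric_space \<Rightarrow> 'a) \<Rightarrow> 'a set \<Rightarrow> 'a set" where
  "basin N f A = \<Union>{U. attracts N f A U}"

definition dual_repeller :: "nat \<Rightarrow> (nat \<Rightarrow> 'a::metric_space \<Rightarrow> 'a) \<Rightarrow> 'a set \<Rightarrow> 'a set" where
  "dual_repeller N f A = - basin N f A"

definition pos_letters :: "nat \<Rightarrow> int set" where
  "pos_letters N = {1..int N}"

definition neg_letters :: "nat \<Rightarrow> int set" where
  "neg_letters N = {- int N..- 1}"

text \<open>Infinite words are functions on \<^typ>\<open>nat\<close>: the letter with index \<open>j \<ge> 1\<close> is \<open>\<iota> (j - 1)\<close>.\<close>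

definition pos_words :: "nat \<Rightarrow> (nat \<Rightarrow> int) set" where
  "pos_words N = {\<iota>. \<forall>i. \<iota> i \<in> pos_letters N}"

definition reduced_words :: "nat \<Rightarrow> (nat \<Rightarrow> int) set" where
  "reduced_words N =
     {\<iota>. (\<forall>i. \<iota> i \<in> pos_letters N \<union> neg_letters N) \<and> (\<forall>i. \<iota> i \<noteq> - \<iota> (Suc i))}"

definition hat_words :: "nat \<Rightarrow> (nat \<Rightarrow> int) set" where
  "hat_words N = {\<iota> \<in> reduced_words N.
     \<exists>k. (\<forall>j<k. \<iota> j \<in> neg_letters N) \<and> (\<forall>j\<ge>k. \<iota> j \<in> pos_letters N)}"

definition hat_words_dual :: "nat \<Rightarrow> (nat \<Rightarrow> int) set" where
  "hat_words_dual N = {\<iota> \<in> reduced_words N.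
     \<exists>k. (\<forall>j<k. \<iota> j \<in> pos_letters N) \<and> (\<forall>j\<ge>k. \<iota> j \<in> neg_letters N)}"

definition word_shift :: "int \<Rightarrow> (nat \<Rightarrow> int) \<Rightarrow> nat \<Rightarrow> int" where
  "word_shift n \<iota> = (if \<iota> 0 \<noteq> - n then case_nat n \<iota> else (\<lambda>i. \<iota> (Suc i)))"

definition letter_map :: "(nat \<Rightarrow> 'a \<Rightarrow> 'a) \<Rightarrow> int \<Rightarrow> 'a \<Rightarrow> 'a" where
  "letter_map f n = (if n > 0 then f (nat n) else inv (f (nat (- n))))"

primrec word_map :: "(nat \<Rightarrow> 'a \<Rightarrow> 'a) \<Rightarrow> (nat \<Rightarrow> int) \<Rightarrow> nat \<Rightarrow> 'a \<Rightarrow> 'a" where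
  "word_map f \<iota> 0 = id"
| "word_map f \<iota> (Suc k) = word_map f \<iota> k \<circ> letter_map f (\<iota> k)"

text \<open>
  For the dual system the maps are again indexed by positive letters, so a word
  \<open>\<iota>\<close> over the negative letters of \<open>f\<close> appears as the positive word \<open>- \<iota>\<close> of \<open>dual f\<close>.
\<close>

definition point_fibred :: "nat \<Rightarrow> (nat \<Rightarrow> 'a::metric_space \<Rightarrow> 'a) \<Rightarrow> 'a set \<Rightarrow> bool" where
  "point_fibred N f A \<longleftrightarrow>
     (\<forall>\<iota>\<in>pos_words N. \<exists>a\<in>A. \<forall>C\<in>hyperspace. C \<subseteq> basin N f A \<longrightarrow>
        hausdorff_lim (\<lambda>k. word_map f \<iota> k ` C) {a})"

definition lim_on :: "(nat \<Rightarrow> 'a::metric_space \<Rightarrow> 'a) \<Rightarrow> 'a set \<Rightarrow> (nat \<Rightarrow> int) \<Rightarrow> 'a" where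
  "lim_on f B \<iota> = (THE x. \<forall>b\<in>B. (\<lambda>k. word_map f \<iota> k b) \<longlonglongrightarrow> x)"

definition coding_map :: "nat \<Rightarrow> (nat \<Rightarrow> 'a::metric_space \<Rightarrow> 'a) \<Rightarrow> 'a set \<Rightarrow> (nat \<Rightarrow> int) \<Rightarrow> 'a" where
  "coding_map N f A = lim_on f (basin N f A)"

text \<open>The dual coding map composes the same maps \<open>f\<^sub>n\<close>, \<open>n \<in> I\<close>, along the word;
  only the base point is taken from the basin of \<open>A\<^sup>*\<close> under the dual system.\<close>

definition coding_map_dual :: "nat \<Rightarrow> (nat \<Rightarrow> 'a::metric_space \<Rightarrow> 'a) \<Rightarrow> 'a set \<Rightarrow> (nat \<Rightarrow> int) \<Rightarrow> 'a" where
  "coding_map_dual N f A = lim_on f (basin N (dual f) (dual_repeller N f A))"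

text \<open>
  Pitfall: on a two-point space \<open>{a, b}\<close> with all maps the identity, \<open>A = {a}\<close> and
  \<open>A\<^sup>* = {b}\<close> are point-fibred attractors of the system and of its dual, both open, yet the
  coding map is constantly \<open>a\<close> and the dual one constantly \<open>b\<close>. Surjectivity of the coding
  maps on a compact space therefore has to exclude spaces with exactly two points.
\<close>

end

theory Submission
  imports Defs
begin

text \<open>Along a positive word the images of a compact subset of the basin shrink to one point of
  \<open>A\<close>. Since \<open>A\<close> is the union of its images, predecessors can be chosen
  inside \<open>A\<close> forever, and this gives every point of \<open>A\<close> a positive code
  (\<open>attractor_coded\<close>). A negative letter put in front of a code acts as an inverse map,
  so the points coded by \<open>hat_words\<close> are closed under all \<open>inv (f n)\<close>. If
  \<open>\<iota>\<close> codes an interior point of \<open>A\<close>, the images of a basin point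
  \<open>x\<close> along \<open>\<iota>\<close> enter \<open>A\<close>, where points are coded;
  going back by inverse letters codes \<open>x\<close> itself
  (\<open>basin_subset_coding_image\<close>). In the contractive case the basin is the whole space
  (\<open>basin_contractive\<close>).

  On a compact space the basin of \<open>A\<close> and that of the dual repeller cover everything.
  The closure of the set of missed points is mapped into itself by each \<open>f n\<close>, hence
  lies in each of its images under the inverses; shrinking in the dual system leaves one common
  fixed point \<open>p\<close>. The dual repeller is then \<open>{p}\<close>, and having interior it
  makes \<open>p\<close> isolated. The complement of \<open>p\<close> is compact, invariant and
  inside the basin of \<open>A\<close>, so it is one point too, and the space has two points, which
  is excluded (\<open>coding_map_surj\<close>). Changing the sign of all letters carries everything
  over to the dual coding map.\<close>

section \<open>Estimates for the Hausdorff distance\<close>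

text \<open>Boundedness of \<open>S\<close> bounds the family under the supremum, so that the
  real-valued \<open>SUP\<close> really is an upper bound.\<close>

lemma infdist_le_hausdist:
  assumes "bounded S" "T \<noteq> {}" "x \<in> S"
  shows "infdist x T \<le> hausdist S T"
proof -
  obtain t where t: "t \<in> T" using assms(2) by blast
  obtain e where e: "\<And>y. y \<in> S \<Longrightarrow> dist t y \<le> e"
    using assms(1) bounded_any_center[of S t] by blast
  have "bdd_above ((\<lambda>x. infdist x T) ` S)"
  proof (rule bdd_aboveI2)
    fix y assume "y \<in> S"
    then show "infdist y T \<le> e"
      using infdist_le[OF t, of y] e[of y] by (simp add: dist_commute)
  qed
  then have "infdist x T \<le> (SUP x\<in>S. infdist x T)"
    using assms(3) by (intro cSUP_upper)
  then show ?thesis by (simp add: hausdist_def)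
qed

lemma hausdist_bounds:
  assumes "S \<noteq> {}" "T \<noteq> {}"
    and "\<And>x. x \<in> S \<Longrightarrow> \<exists>y\<in>T. dist x y \<le> e"
    and "\<And>y. y \<in> T \<Longrightarrow> \<exists>x\<in>S. dist x y \<le> e"
  shows "0 \<le> hausdist S T" "hausdist S T \<le> e"
proof -
  have S: "infdist x T \<le> e" if "x \<in> S" for x
    using assms(3)[OF that] by (blast intro: infdist_le2)
  have T: "infdist y S \<le> e" if "y \<in> T" for y
    using assms(4)[OF that] by (metis dist_commute infdist_le2)
  show "hausdist S T \<le> e"
    unfolding hausdist_def using assms(1,2) S T by (intro max.boundedI cSUP_least)
  obtain x where x: "x \<in> S" using assms(1) by blast
  have "bdd_above ((\<lambda>x. infdist x T) ` S)" using S by (rule bdd_aboveI2)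
  then have "infdist x T \<le> (SUP x\<in>S. infdist x T)" using x by (intro cSUP_upper)
  then show "0 \<le> hausdist S T"
    unfolding hausdist_def using infdist_nonneg[of x T] by linarith
qed

lemma hausdorff_lim_singletonD:
  assumes "hausdorff_lim S {a}" "\<And>k. bounded (S k)" "\<And>k. x k \<in> S k"
  shows "x \<longlonglongrightarrow> a"
proof -
  have "dist (x k) a \<le> hausdist (S k) {a}" for k
    using infdist_le_hausdist[of "S k" "{a}" "x k"] assms(2,3) by simp
  then have "(\<lambda>k. dist (x k) a) \<longlonglongrightarrow> 0"
    by (intro Lim_null_comparison[OF _ assms(1)[unfolded hausdorff_lim_def]]) auto
  then show ?thesis by (rule tendsto_dist_iff[THEN iffD2])
qed

section \<open>Words, letters and the shift\<close>

lemma word_map_add: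
  "word_map f \<iota> (j + k) = word_map f \<iota> j \<circ> word_map f (\<lambda>i. \<iota> (j + i)) k"
  by (induction k) (auto simp: fun_eq_iff)

lemma word_map_Suc_left:
  "word_map f \<iota> (Suc k) x = letter_map f (\<iota> 0) (word_map f (\<lambda>i. \<iota> (Suc i)) k x)"
  using word_map_add[of f \<iota> 1 k] by (simp add: fun_eq_iff)

lemma letter_map_pos:
  assumes "n \<in> pos_letters N"
  shows "letter_map f n = f (nat n)" "nat n \<in> {1..N}"
  using assms by (auto simp: letter_map_def pos_letters_def)

lemma letter_map_neg:
  assumes "n \<in> neg_letters N"
  shows "letter_map f n = inv (f (nat (- n)))" "nat (- n) \<in> {1..N}"
  using assms by (auto simp: letter_map_def neg_letters_def)

lemma uminus_letters [simp]:
  "- n \<in> pos_letters N \<longleftrightarrow> n \<in> neg_letters N"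
  "- n \<in> neg_letters N \<longleftrightarrow> n \<in> pos_letters N"
  by (auto simp: pos_letters_def neg_letters_def)

text \<open>Prepending lengthens the negative block by one. Cancellation requires a positive first
  letter, so the negative block is empty and a positive word remains.\<close>

lemma word_shift_hat_words:
  assumes n: "n \<in> neg_letters N" and \<iota>: "\<iota> \<in> hat_words N"
  shows "word_shift n \<iota> \<in> hat_words N"
proof -
  obtain k where k: "\<And>j. j < k \<Longrightarrow> \<iota> j \<in> neg_letters N" "\<And>j. k \<le> j \<Longrightarrow> \<iota> j \<in> pos_letters N"
    and r: "\<And>i. \<iota> i \<in> pos_letters N \<union> neg_letters N" "\<And>i. \<iota> i \<noteq> - \<iota> (Suc i)"
    using \<iota> unfolding hat_words_def reduced_words_def by blast
  show ?thesis
  proof (cases "\<iota> 0 = - n")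
    case True
    then have "k = 0"
      using k(1)[of 0] n by (auto simp: pos_letters_def neg_letters_def)
    then have "\<And>j. \<iota> (Suc j) \<in> pos_letters N" using k(2) by simp
    then show ?thesis
      using True r by (auto simp: word_shift_def hat_words_def reduced_words_def)
  next
    case False
    have "\<forall>i. case_nat n \<iota> i \<in> pos_letters N \<union> neg_letters N"
      using n r(1) by (auto split: nat.split)
    moreover have "\<forall>i. case_nat n \<iota> i \<noteq> - case_nat n \<iota> (Suc i)"
      using False r(2) by (auto split: nat.split)
    moreover have "\<forall>j<Suc k. case_nat n \<iota> j \<in> neg_letters N"
      using n k(1) by (auto split: nat.split)
    moreover have "\<forall>j\<ge>Suc k. case_nat n \<iota> j \<in> pos_letters N"
      using k(2) by (auto split: nat.split)
    ultimately show ?thesis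
      using False unfolding word_shift_def hat_words_def reduced_words_def by auto
  qed
qed

lemma pos_words_subset_hat_words: "pos_words N \<subseteq> hat_words N"
proof
  fix \<iota> assume "\<iota> \<in> pos_words N"
  then have p: "\<And>i. \<iota> i \<in> pos_letters N" by (simp add: pos_words_def)
  have "\<iota> i \<noteq> - \<iota> (Suc i)" for i
    using p[of i] p[of "Suc i"] by (auto simp: pos_letters_def)
  then show "\<iota> \<in> hat_words N"
    using p by (auto simp: hat_words_def reduced_words_def)
qed

section \<open>Systems of homeomorphisms and their duals\<close>

locale homeo_ifs =
  fixes N :: nat and f :: "nat \<Rightarrow> 'a::complete_space \<Rightarrow> 'a"
  assumes ifs: "ifs N f"
begin

lemma N_pos: "N \<ge> 1"
  using ifs by (simp add: ifs_def)

lemma homeo: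
  assumes "n \<in> {1..N}"
  shows "bij (f n)" "continuous_on UNIV (f n)" "continuous_on UNIV (inv (f n))"
proof -
  obtain g where g: "homeomorphism UNIV UNIV (f n) g"
    using ifs assms unfolding ifs_def by blast
  then have "inv (f n) = g"
    by (intro inv_unique_comp) (auto simp: homeomorphism_def fun_eq_iff)
  with g show "continuous_on UNIV (f n)" "continuous_on UNIV (inv (f n))"
    by (auto simp: homeomorphism_def)
  show "bij (f n)"
    using g by (intro o_bij[of g]) (auto simp: homeomorphism_def fun_eq_iff)
qed

lemma letter_map_continuous:
  assumes "n \<in> pos_letters N \<union> neg_letters N"
  shows "continuous_on UNIV (letter_map f n)"
  using assms
proof
  assume n: "n \<in> pos_letters N"
  show ?thesis using homeo(2)[OF letter_map_pos(2)[OF n]] by (simp only: letter_map_pos(1)[OF n])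
next
  assume n: "n \<in> neg_letters N"
  show ?thesis using homeo(3)[OF letter_map_neg(2)[OF n]] by (simp only: letter_map_neg(1)[OF n])
qed

lemma letter_map_cancel:
  assumes "n \<in> pos_letters N \<union> neg_letters N"
  shows "letter_map f n (letter_map f (- n) x) = x"
proof (cases "n \<in> pos_letters N")
  case True
  then show ?thesis
    using homeo(1)[OF letter_map_pos(2)[OF True]]
    by (simp add: letter_map_pos(1)[OF True] letter_map_neg(1)[of "- n" N] bij_is_surj surj_f_inv_f)
next
  case False
  then have n: "n \<in> neg_letters N" using assms by blast
  then show ?thesis
    using homeo(1)[OF letter_map_neg(2)[OF n]]
    by (simp add: letter_map_neg(1)[OF n] letter_map_pos(1)[of "- n" N] bij_is_inj)
qed

lemma letter_map_tendsto:
  assumes "n \<in> pos_letters N \<union> neg_letters N" "x \<longlonglongrightarrow> l"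
  shows "(\<lambda>k. letter_map f n (x k)) \<longlonglongrightarrow> letter_map f n l"
  using continuous_on_tendsto_compose[OF letter_map_continuous[OF assms(1)] assms(2)] by simp

lemma word_map_continuous:
  assumes "\<And>i. \<iota> i \<in> pos_letters N \<union> neg_letters N"
  shows "continuous_on UNIV (word_map f \<iota> k)"
proof (induction k)
  case (Suc k)
  show ?case
    unfolding word_map.simps
    by (intro continuous_on_compose letter_map_continuous[OF assms] continuous_on_subset[OF Suc])
      auto
qed (simp add: id_def)

text \<open>Maps with other indices are arbitrary, so \<open>dual (dual f)\<close> and
  \<open>f\<close> may differ as functions. Hence \<open>coding_map_surj\<close> compares two
  systems on \<open>{1..N}\<close> only.\<close>

lemma dual_dual:
  assumes "n \<in> {1..N}"
  shows "dual (dual f) n = f n"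
  using homeo(1)[OF assms] by (simp add: dual_def inv_inv_eq)

lemma ifs_dual: "ifs N (dual f)"
  unfolding ifs_def dual_def
proof (intro conjI ballI)
  fix n assume n: "n \<in> {1..N}"
  have "homeomorphism UNIV UNIV (inv (f n)) (f n)"
    using homeo[OF n]
    by (auto simp: homeomorphism_def bij_is_inj bij_is_surj surj_f_inv_f bij_imp_bij_inv)
  then show "\<exists>g. homeomorphism UNIV UNIV (inv (f n)) g" by blast
qed (rule N_pos)

lemma letter_map_dual:
  assumes "n \<in> pos_letters N \<union> neg_letters N"
  shows "letter_map (dual f) (- n) = letter_map f n"
proof (cases "n \<in> pos_letters N")
  case True
  then show ?thesis
    using dual_dual[OF letter_map_pos(2)[OF True]]
    by (simp add: letter_map_pos(1)[OF True] letter_map_neg(1)[of "- n" N] dual_def)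
next
  case False
  then have n: "n \<in> neg_letters N" using assms by blast
  then show ?thesis
    by (simp add: letter_map_neg(1)[OF n] letter_map_pos(1)[of "- n" N] dual_def)
qed

lemma word_map_dual:
  assumes "\<And>i. \<iota> i \<in> pos_letters N \<union> neg_letters N"
  shows "word_map (dual f) (\<lambda>i. - \<iota> i) k = word_map f \<iota> k"
  by (induction k) (simp_all add: letter_map_dual[OF assms])

text \<open>Used together with \<open>pos_word_limit\<close>: such a \<open>C\<close> stays inside
  images that shrink to a point.\<close>

lemma subset_word_map_image:
  assumes "\<iota> \<in> pos_words N" "\<And>n. n \<in> {1..N} \<Longrightarrow> C \<subseteq> f n ` C"
  shows "C \<subseteq> word_map f \<iota> k ` C"
proof (induction k)
  case (Suc k)
  have l: "\<iota> k \<in> pos_letters N" using assms(1) by (simp add: pos_words_def)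
  have "C \<subseteq> letter_map f (\<iota> k) ` C"
    using assms(2)[OF letter_map_pos(2)[OF l]] by (simp only: letter_map_pos(1)[OF l])
  then have "word_map f \<iota> k ` C \<subseteq> word_map f \<iota> (Suc k) ` C"
    by (auto simp: image_comp[symmetric])
  with Suc show ?case by blast
qed simp

end

section \<open>Codes of points\<close>

locale fibred_attractor = homeo_ifs N f
  for N :: nat and f :: "nat \<Rightarrow> 'a::complete_space \<Rightarrow> 'a" +
  fixes A :: "'a set"
  assumes attractor: "attractor N f A" and point_fibred: "point_fibred N f A"
begin

text \<open>Relational form of the coding map: limits can be transported before the definite
  description in \<open>lim_on\<close> is known to be meaningful.\<close>

definition codes :: "(nat \<Rightarrow> int) \<Rightarrow> 'a \<Rightarrow> bool" where
  "codes \<iota> x \<longleftrightarrow> (\<forall>b\<in>basin N f A. (\<lambda>k. word_map f \<iota> k b) \<longlonglongrightarrow> x)"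

lemma A_compact: "compact A" and A_nonempty: "A \<noteq> {}"
  using attractor by (auto simp: attractor_def hyperspace_def)

lemma A_subset_basin: "A \<subseteq> basin N f A"
  using attractor by (auto simp: attractor_def attracts_def basin_def)

lemma open_basin: "open (basin N f A)"
  unfolding basin_def by (auto simp: attracts_def)

lemma codes_unique: "codes \<iota> x \<Longrightarrow> codes \<iota> y \<Longrightarrow> x = y"
  using A_nonempty A_subset_basin LIMSEQ_unique unfolding codes_def by blast

lemma coding_map_eq: "codes \<iota> x \<Longrightarrow> coding_map N f A \<iota> = x"
  unfolding coding_map_def lim_on_def
  by (rule the_equality) (auto simp: codes_def[symmetric] intro: codes_unique)

text \<open>Point-fibredness in terms of sequences. The base point in \<open>C\<close> may vary with
  \<open>k\<close>, which covers both moving predecessors and constant sequences.\<close>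

lemma pos_word_limit:
  assumes \<iota>: "\<iota> \<in> pos_words N"
  obtains a where "a \<in> A" "codes \<iota> a"
    "\<And>C x. \<lbrakk>compact C; C \<subseteq> basin N f A; \<And>k. x k \<in> word_map f \<iota> k ` C\<rbrakk> \<Longrightarrow> x \<longlonglongrightarrow> a"
proof -
  obtain a where a: "a \<in> A"
    and lim: "\<And>C. C \<in> hyperspace \<Longrightarrow> C \<subseteq> basin N f A \<Longrightarrow>
      hausdorff_lim (\<lambda>k. word_map f \<iota> k ` C) {a}"
    using bspec[OF point_fibred[unfolded point_fibred_def] \<iota>] by auto
  have *: "x \<longlonglongrightarrow> a"
    if "compact C" "C \<subseteq> basin N f A" "\<And>k. x k \<in> word_map f \<iota> k ` C" for C x
  proof (rule hausdorff_lim_singletonD[OF lim[of C]])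
    \<comment> \<open>\<open>C\<close> is nonempty because \<open>x 0\<close> lies in one of its
      images.\<close>
    show "C \<in> hyperspace" using that(1) that(3)[of 0] by (auto simp: hyperspace_def)
    show "bounded (word_map f \<iota> k ` C)" for k
      using \<iota> that(1) by (intro compact_imp_bounded compact_continuous_image
          continuous_on_subset[OF word_map_continuous]) (auto simp: pos_words_def)
  qed (fact that)+
  have "codes \<iota> a"
    unfolding codes_def
  proof
    fix b assume "b \<in> basin N f A"
    then show "(\<lambda>k. word_map f \<iota> k b) \<longlonglongrightarrow> a"
      by (intro *[of "{b}"]) auto
  qed
  with a show thesis using * by (rule that)
qed

text \<open>Iterated predecessors \<open>z k\<close> in \<open>A\<close> give
  \<open>a = word_map f \<iota> k (z k)\<close> for all \<open>k\<close>, so the constant sequence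
  \<open>a\<close> runs through the shrinking images of \<open>A\<close> and must equal their
  limit.\<close>

lemma attractor_coded:
  assumes "a \<in> A"
  obtains \<iota> where "\<iota> \<in> pos_words N" "codes \<iota> a"
proof -
  have "\<forall>x\<in>A. \<exists>p. fst p \<in> {1..N} \<and> snd p \<in> A \<and> f (fst p) (snd p) = x"
  proof
    fix x assume "x \<in> A"
    then have "x \<in> hutch N f A" using attractor by (simp add: attractor_def)
    then obtain n y where "n \<in> {1..N}" "y \<in> A" "x = f n y" unfolding hutch_def by blast
    then show "\<exists>p. fst p \<in> {1..N} \<and> snd p \<in> A \<and> f (fst p) (snd p) = x"
      by (intro exI[of _ "(n, y)"]) simp
  qed
  then obtain h where h: "\<forall>x\<in>A. fst (h x) \<in> {1..N} \<and> snd (h x) \<in> A \<and> f (fst (h x)) (snd (h x)) = x"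
    by (rule bchoice[THEN exE])
  define n where "n x = fst (h x)" for x
  define y where "y x = snd (h x)" for x
  have n: "n x \<in> {1..N}" and y: "y x \<in> A" "f (n x) (y x) = x" if "x \<in> A" for x
    using bspec[OF h that] by (simp_all add: n_def y_def)
  \<comment> \<open>\<open>z k\<close> is the \<open>k\<close>-fold predecessor of \<open>a\<close>;
    the letter \<open>\<iota> k\<close> leads from \<open>z (Suc k)\<close> back to
    \<open>z k\<close>.\<close>
  define z where "z k = (y ^^ k) a" for k
  define \<iota> where "\<iota> k = int (n (z k))" for k
  have z: "z k \<in> A" for k
    by (induction k) (use assms y(1) in \<open>auto simp: z_def\<close>)
  have \<iota>: "\<iota> \<in> pos_words N"
    using n[OF z] by (auto simp: pos_words_def pos_letters_def \<iota>_def)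
  have a: "a = word_map f \<iota> k (z k)" for k
  proof (induction k)
    case (Suc k)
    have "letter_map f (\<iota> k) (z (Suc k)) = z k"
      using n[OF z[of k]] y(2)[OF z[of k]] by (simp add: letter_map_def \<iota>_def z_def)
    with Suc show ?case by simp
  qed (simp add: z_def)
  obtain a' where a': "codes \<iota> a'"
    "\<And>C x. \<lbrakk>compact C; C \<subseteq> basin N f A; \<And>k. x k \<in> word_map f \<iota> k ` C\<rbrakk> \<Longrightarrow> x \<longlonglongrightarrow> a'"
    using pos_word_limit[OF \<iota>] by metis
  have "(\<lambda>k::nat. a) \<longlonglongrightarrow> a'"
    by (rule a'(2)[OF A_compact A_subset_basin]) (use a z in \<open>rule image_eqI\<close>)
  then have "a' = a" by (simp add: LIMSEQ_const_iff)
  with a'(1) show thesis using that[OF \<iota>] by simp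
qed

lemma codes_append:
  assumes "\<And>i. \<iota> i \<in> pos_letters N \<union> neg_letters N" "codes (\<lambda>i. \<iota> (j + i)) x"
  shows "codes \<iota> (word_map f \<iota> j x)"
  unfolding codes_def
proof
  fix b assume "b \<in> basin N f A"
  then have "(\<lambda>k. word_map f (\<lambda>i. \<iota> (j + i)) k b) \<longlonglongrightarrow> x"
    using assms(2) by (simp add: codes_def)
  then have "(\<lambda>k. word_map f \<iota> j (word_map f (\<lambda>i. \<iota> (j + i)) k b)) \<longlonglongrightarrow> word_map f \<iota> j x"
    using continuous_on_tendsto_compose[OF word_map_continuous[OF assms(1)]] by simp
  then have "(\<lambda>k. word_map f \<iota> (k + j) b) \<longlonglongrightarrow> word_map f \<iota> j x"
    by (simp add: add.commute[of _ j] word_map_add)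
  then show "(\<lambda>k. word_map f \<iota> k b) \<longlonglongrightarrow> word_map f \<iota> j x"
    by (rule LIMSEQ_offset)
qed

lemma hat_word_codes:
  assumes "\<iota> \<in> hat_words N"
  shows "codes \<iota> (coding_map N f A \<iota>)"
proof -
  obtain k where k: "\<And>j. k \<le> j \<Longrightarrow> \<iota> j \<in> pos_letters N"
    and r: "\<And>i. \<iota> i \<in> pos_letters N \<union> neg_letters N"
    using assms unfolding hat_words_def reduced_words_def by blast
  have "(\<lambda>i. \<iota> (k + i)) \<in> pos_words N"
    using k by (simp add: pos_words_def)
  then obtain a where "codes (\<lambda>i. \<iota> (k + i)) a" by (rule pos_word_limit)
  then have "codes \<iota> (word_map f \<iota> k a)" by (rule codes_append[OF r])
  then show ?thesis by (simp add: coding_map_eq)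
qed

text \<open>Without cancellation this is \<open>codes_append\<close> for a prefix of length one.
  With cancellation, \<open>letter_map f n\<close> removes the first letter from the approximants of
  index \<open>Suc k\<close>, leaving those of the shortened word.\<close>

lemma codes_word_shift:
  assumes n: "n \<in> pos_letters N \<union> neg_letters N"
    and \<iota>: "\<And>i. \<iota> i \<in> pos_letters N \<union> neg_letters N" and c: "codes \<iota> x"
  shows "codes (word_shift n \<iota>) (letter_map f n x)"
proof (cases "\<iota> 0 = - n")
  case False
  have "codes (case_nat n \<iota>) (word_map f (case_nat n \<iota>) 1 x)"
    using n \<iota> c by (intro codes_append) (auto split: nat.split)
  with False show ?thesis by (simp add: word_shift_def)
next
  case True
  show ?thesis
    unfolding codes_def
  proof
    fix b assume "b \<in> basin N f A"
    then have "(\<lambda>k. word_map f \<iota> (Suc k) b) \<longlonglongrightarrow> x"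
      using c by (intro LIMSEQ_Suc) (simp add: codes_def)
    then have "(\<lambda>k. letter_map f n (letter_map f (- n) (word_map f (\<lambda>i. \<iota> (Suc i)) k b)))
        \<longlonglongrightarrow> letter_map f n x"
      using n True by (intro letter_map_tendsto) (simp_all only: word_map_Suc_left)
    then show "(\<lambda>k. word_map f (word_shift n \<iota>) k b) \<longlonglongrightarrow> letter_map f n x"
      using True by (simp add: letter_map_cancel[OF n] word_shift_def)
  qed
qed

lemma coding_map_word_shift:
  assumes "n \<in> neg_letters N" "\<iota> \<in> hat_words N"
  shows "coding_map N f A (word_shift n \<iota>) = letter_map f n (coding_map N f A \<iota>)"
  using assms
  by (intro coding_map_eq codes_word_shift hat_word_codes)
    (auto simp: hat_words_def reduced_words_def)

section \<open>Coding the whole basin\<close>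

text \<open>Stated for the inverses because prepending a positive letter to a word that starts
  negatively can lead out of \<open>hat_words\<close>.\<close>

lemma inv_in_coding_image:
  assumes "x \<in> coding_map N f A ` hat_words N" "n \<in> {1..N}"
  shows "inv (f n) x \<in> coding_map N f A ` hat_words N"
proof -
  obtain \<iota> where \<iota>: "\<iota> \<in> hat_words N" "x = coding_map N f A \<iota>" using assms(1) by blast
  have n: "- int n \<in> neg_letters N" using assms(2) by (simp add: neg_letters_def)
  then have "inv (f n) x = coding_map N f A (word_shift (- int n) \<iota>)"
    using \<iota> coding_map_word_shift[OF n] letter_map_neg(1)[OF n, of f] by simp
  then show ?thesis using word_shift_hat_words[OF n \<iota>(1)] by blast
qed

lemma coding_image_word_map:
  assumes "\<iota> \<in> pos_words N" "word_map f \<iota> k x \<in> coding_map N f A ` hat_words N"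
  shows "x \<in> coding_map N f A ` hat_words N"
  using assms(2)
proof (induction k arbitrary: x)
  case (Suc k)
  have l: "\<iota> k \<in> pos_letters N" using assms(1) by (simp add: pos_words_def)
  from Suc have "f (nat (\<iota> k)) x \<in> coding_map N f A ` hat_words N"
    using letter_map_pos(1)[OF l, of f] by simp
  from inv_in_coding_image[OF this letter_map_pos(2)[OF l]] show ?case
    using homeo(1)[OF letter_map_pos(2)[OF l]] by (simp add: bij_is_inj)
qed simp

text \<open>The orbit of a basin point along the code of an interior point of the attractor
  eventually enters the attractor; the inverse letters then lead back to the basin point.\<close>

lemma basin_subset_coding_image:
  assumes "interior A \<noteq> {}"
  shows "basin N f A \<subseteq> coding_map N f A ` hat_words N"
proof
  fix x assume x: "x \<in> basin N f A"
  obtain a where a: "a \<in> interior A" using assms by blast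
  then have "a \<in> A" using interior_subset by blast
  then obtain \<iota> where \<iota>: "\<iota> \<in> pos_words N" "codes \<iota> a" by (rule attractor_coded)
  then have "(\<lambda>k. word_map f \<iota> k x) \<longlonglongrightarrow> a" using x by (simp add: codes_def)
  then have "\<forall>\<^sub>F k in sequentially. word_map f \<iota> k x \<in> interior A"
    using a by (intro topological_tendstoD) auto
  then obtain k where "word_map f \<iota> k x \<in> interior A"
    by (auto dest: eventually_happens)
  then have "word_map f \<iota> k x \<in> A" using interior_subset by blast
  then obtain \<kappa> where "\<kappa> \<in> pos_words N" "codes \<kappa> (word_map f \<iota> k x)" by (rule attractor_coded)
  then have "word_map f \<iota> k x \<in> coding_map N f A ` hat_words N"
    using coding_map_eq pos_words_subset_hat_words by (metis imageI subsetD)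
  then show "x \<in> coding_map N f A ` hat_words N"
    by (rule coding_image_word_map[OF \<iota>(1)])
qed

section \<open>Compact sets contained in their own images\<close>

lemma const_one_pos_word: "(\<lambda>_. 1) \<in> pos_words N"
  using N_pos by (simp add: pos_words_def pos_letters_def)

text \<open>One word suffices: \<open>C\<close> lies in all its images along it, and these shrink to
  a single point.\<close>

lemma backward_invariant_singleton:
  assumes "compact C" "C \<noteq> {}" "C \<subseteq> basin N f A"
    and inv: "\<And>n. n \<in> {1..N} \<Longrightarrow> C \<subseteq> f n ` C"
  obtains p where "C = {p}" "\<And>n. n \<in> {1..N} \<Longrightarrow> f n p = p"
proof -
  obtain a where a: "\<And>C x. \<lbrakk>compact C; C \<subseteq> basin N f A;
      \<And>k. x k \<in> word_map f (\<lambda>_. 1) k ` C\<rbrakk> \<Longrightarrow> x \<longlonglongrightarrow> a"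
    using pos_word_limit[OF const_one_pos_word] by metis
  have "c = a" if "c \<in> C" for c
  proof -
    have "(\<lambda>k::nat. c) \<longlonglongrightarrow> a"
      using subset_word_map_image[OF const_one_pos_word inv] that
      by (intro a[OF assms(1,3)]) blast
    then show ?thesis by (simp add: LIMSEQ_const_iff)
  qed
  then have C: "C = {a}" using assms(2) by blast
  show thesis
    using inv C by (intro that[of a]) auto
qed

text \<open>With base point \<open>p\<close> every positive word produces a constant sequence, so
  each code of a point of \<open>A\<close> has limit \<open>p\<close>.\<close>

lemma attractor_eq_fixed_point:
  assumes "p \<in> basin N f A" and fixed: "\<And>n. n \<in> {1..N} \<Longrightarrow> f n p = p"
  shows "A = {p}"
proof -
  have "a = p" if "a \<in> A" for a
  proof -
    obtain \<iota> where \<iota>: "\<iota> \<in> pos_words N" "codes \<iota> a"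
      using \<open>a \<in> A\<close> by (rule attractor_coded)
    have "word_map f \<iota> k p = p" for k
      using subset_word_map_image[OF \<iota>(1), of "{p}" k] fixed by auto
    then have "(\<lambda>k::nat. p) \<longlonglongrightarrow> a"
      using \<iota>(2) assms(1) by (auto simp: codes_def)
    then show ?thesis by (simp add: LIMSEQ_const_iff)
  qed
  then show ?thesis using A_nonempty by blast
qed

section \<open>The basin of a contractive system\<close>

text \<open>As \<open>A\<close> is invariant, each application of \<open>hutch N f\<close> shrinks
  the two-sided closeness to \<open>A\<close> by the factor \<open>c\<close>, for any compact
  starting set.\<close>

lemma basin_contractive:
  assumes "contractive N f"
  shows "basin N f A = UNIV"
proof -
  obtain c where c: "0 \<le> c" "c < 1"
    and le: "\<And>n x y. n \<in> {1..N} \<Longrightarrow> dist (f n x) (f n y) \<le> c * dist x y"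
    using assms unfolding contractive_def by blast
  have FA: "hutch N f A = A" using attractor by (simp add: attractor_def)
  have "hausdorff_lim (\<lambda>k. (hutch N f ^^ k) C) A" if "C \<in> hyperspace" for C
  proof -
    have "compact C" "C \<noteq> {}" using that by (auto simp: hyperspace_def)
    then have "bounded (C \<union> A)" using A_compact by (simp add: compact_imp_bounded)
    then obtain M where M: "\<And>x y. x \<in> C \<union> A \<Longrightarrow> y \<in> C \<union> A \<Longrightarrow> dist x y \<le> M"
      unfolding bounded_two_points by blast
    \<comment> \<open>Nonemptiness is carried along because \<open>hausdist_bounds\<close> needs it
      for the suprema.\<close>
    have close: "(hutch N f ^^ k) C \<noteq> {} \<and>
      (\<forall>x\<in>(hutch N f ^^ k) C. \<exists>a\<in>A. dist x a \<le> c ^ k * M) \<and>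
      (\<forall>a\<in>A. \<exists>x\<in>(hutch N f ^^ k) C. dist x a \<le> c ^ k * M)" for k
    proof (induction k)
      case 0
      have "\<exists>a\<in>A. dist x a \<le> M" if "x \<in> C" for x
        using A_nonempty M that by blast
      moreover have "\<exists>x\<in>C. dist x a \<le> M" if "a \<in> A" for a
        using \<open>C \<noteq> {}\<close> M that by blast
      ultimately show ?case using \<open>C \<noteq> {}\<close> by simp
    next
      case (Suc k)
      let ?D = "(hutch N f ^^ k) C"
      have step: "dist (f n x) (f n y) \<le> c ^ Suc k * M"
        if "n \<in> {1..N}" "dist x y \<le> c ^ k * M" for n x y
        using order_trans[OF le[OF that(1)] mult_left_mono[OF that(2) c(1)]]
        by (simp add: mult.assoc)
      from Suc have ne: "?D \<noteq> {}" and near: "\<And>x. x \<in> ?D \<Longrightarrow> \<exists>a\<in>A. dist x a \<le> c ^ k * M"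
        "\<And>a. a \<in> A \<Longrightarrow> \<exists>x\<in>?D. dist x a \<le> c ^ k * M"
        using Suc by auto
      have "hutch N f S \<noteq> {}" if "S \<noteq> {}" for S
        using that N_pos by (auto simp: hutch_def)
      then have "hutch N f ?D \<noteq> {}"
        using ne by blast
      moreover have "\<exists>a\<in>A. dist x a \<le> c ^ Suc k * M" if "x \<in> hutch N f ?D" for x
      proof -
        obtain n d where nd: "n \<in> {1..N}" "d \<in> ?D" "x = f n d"
          using \<open>x \<in> hutch N f ?D\<close> unfolding hutch_def[of N f ?D] by blast
        then obtain a where a: "a \<in> A" "dist d a \<le> c ^ k * M" using near(1) by blast
        then have "f n a \<in> A" using nd(1) FA unfolding hutch_def by blast
        then show ?thesis using step[OF nd(1) a(2)] nd(3) by blast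
      qed
      moreover have "\<exists>x\<in>hutch N f ?D. dist x a \<le> c ^ Suc k * M" if "a \<in> A" for a
      proof -
        have "a \<in> hutch N f A" using that by (simp only: FA)
        then obtain n a' where na: "n \<in> {1..N}" "a' \<in> A" "a = f n a'"
          unfolding hutch_def by blast
        then obtain d where d: "d \<in> ?D" "dist d a' \<le> c ^ k * M" using near(2) by blast
        then have "f n d \<in> hutch N f ?D" using na(1) unfolding hutch_def[of N f ?D] by blast
        then show ?thesis using step[OF na(1) d(2)] na(3) by blast
      qed
      ultimately show ?case unfolding funpow.simps comp_apply by blast
    qed
    have "0 \<le> hausdist ((hutch N f ^^ k) C) A" "hausdist ((hutch N f ^^ k) C) A \<le> c ^ k * M" for k
      using hausdist_bounds[OF conjunct1[OF close] A_nonempty, of k "c ^ k * M"] close[of k] by blast+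
    then have "\<forall>\<^sub>F k in sequentially. norm (hausdist ((hutch N f ^^ k) C) A) \<le> c ^ k * M"
      by (simp add: always_eventually)
    moreover have "(\<lambda>k. c ^ k * M) \<longlonglongrightarrow> 0"
      by (rule tendsto_mult_left_zero[OF LIMSEQ_realpow_zero[OF c]])
    ultimately show ?thesis
      unfolding hausdorff_lim_def by (rule Lim_null_comparison)
  qed
  then have "attracts N f A UNIV" by (simp add: attracts_def)
  then show ?thesis by (auto simp: basin_def)
qed

end

section \<open>Surjectivity on a compact space\<close>

text \<open>The two basins cover the space in both applications (the roles of the system and its dual
  being exchanged), because a basin contains its attractor. A proper image of the coding map
  leaves a compact set that the inverse system reproduces, hence a common fixed point that is an
  isolated point and the whole attractor of the inverse system; its complement is then a single
  point for the same reason.\<close>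

lemma coding_map_surj:
  fixes f g :: "nat \<Rightarrow> 'a::complete_space \<Rightarrow> 'a"
  assumes "fibred_attractor N f A" "fibred_attractor N g B"
    and g: "\<And>n. n \<in> {1..N} \<Longrightarrow> g n = inv (f n)"
    and X: "compact (UNIV :: 'a set)" "card (UNIV :: 'a set) \<noteq> 2"
    and cover: "basin N f A \<union> basin N g B = UNIV"
    and int: "interior A \<noteq> {}" "interior B \<noteq> {}"
  shows "coding_map N f A ` hat_words N = UNIV"
proof (rule ccontr)
  interpret f: fibred_attractor N f A by fact
  interpret g: fibred_attractor N g B by fact
  define R where "R = coding_map N f A ` hat_words N"
  \<comment> \<open>Taking the closure gives compactness, and it stays disjoint from the basin of
    \<open>A\<close> because that basin is open.\<close>
  define C where "C = closure (- R)"
  assume "coding_map N f A ` hat_words N \<noteq> UNIV"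
  then have "C \<noteq> {}" by (auto simp: C_def R_def)
  have "compact C" using compact_Int_closed[OF X(1), of C] by (simp add: C_def)
  have "- R \<subseteq> - basin N f A"
    using f.basin_subset_coding_image[OF int(1)] by (auto simp: R_def)
  then have C: "C \<subseteq> - basin N f A"
    unfolding C_def using f.open_basin by (intro closure_minimal) auto
  \<comment> \<open>\<open>R\<close> is closed under the inverses, so \<open>f n\<close> maps its
    complement, and by continuity \<open>C\<close>, into itself; applying \<open>inv (f n)\<close>
    turns this into the claim.\<close>
  have "C \<subseteq> g n ` C" if n: "n \<in> {1..N}" for n
  proof -
    have inv: "inv (f n) (f n x) = x" for x
      using f.homeo(1)[OF n] by (simp add: bij_is_inj)
    have "x \<in> R" if "f n x \<in> R" for x
      using f.inv_in_coding_image[OF that[unfolded R_def] n] by (simp add: inv R_def)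
    then have "f n ` (- R) \<subseteq> - R" by blast
    then have "f n ` C \<subseteq> C"
      unfolding C_def
      by (intro image_closure_subset continuous_on_subset[OF f.homeo(2)[OF n]])
        (use closure_subset in blast)+
    then have "inv (f n) ` f n ` C \<subseteq> inv (f n) ` C" by (rule image_mono)
    then show ?thesis by (simp add: g[OF n] image_image inv)
  qed
  moreover have "C \<subseteq> basin N g B" using C cover by blast
  ultimately obtain p where p: "C = {p}" "\<And>n. n \<in> {1..N} \<Longrightarrow> g n p = p"
    using g.backward_invariant_singleton[OF \<open>compact C\<close> \<open>C \<noteq> {}\<close>] by metis
  have "p \<in> basin N g B" using C cover p(1) by blast
  then have B: "B = {p}" using p(2) by (rule g.attractor_eq_fixed_point)
  then have "interior {p} = {p}" using int(2) interior_subset[of B] by (simp add: subset_singleton_iff)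
  then have op: "open {p}" by (metis open_interior)
  define Y where "Y = - {p}"
  have "compact Y" using compact_Int_closed[OF X(1), of Y] op by (simp add: Y_def closed_Compl)
  have fp: "f n p = p" if "n \<in> {1..N}" for n
    using p(2)[OF that] bij_inv_eq_iff[OF f.homeo(1)[OF that], of p p] by (simp add: g[OF that])
  have Yf: "Y \<subseteq> f n ` Y" if "n \<in> {1..N}" for n
    using fp[OF that] f.homeo(1)[OF that] unfolding Y_def
    by (simp add: bij_image_Compl_eq)
  have Yg: "word_map g (\<lambda>_. 1) k x \<in> Y" if "x \<in> Y" for k x
    using that
  proof (induction k arbitrary: x)
    case (Suc k)
    have 1: "1 \<in> {1..N}" using g.N_pos by simp
    have "g 1 x \<noteq> g 1 p" using Suc.prems g.homeo(1)[OF 1] by (auto simp: Y_def bij_is_inj inj_eq)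
    then have "g 1 x \<in> Y" using p(2)[OF 1] by (simp add: Y_def)
    with Suc.IH show ?case by (simp add: letter_map_def)
  qed simp
  \<comment> \<open>Otherwise some \<open>x\<close> in \<open>Y\<close> lies in the basin of
    \<open>B = {p}\<close>, so its iterates under \<open>g 1\<close> converge to \<open>p\<close>
    and, \<open>p\<close> being isolated, hit it. By injectivity no point other than the fixed point
    \<open>p\<close> can do so.\<close>
  have "Y \<subseteq> basin N f A"
  proof (rule ccontr)
    assume "\<not> Y \<subseteq> basin N f A"
    then obtain x where x: "x \<in> Y" "x \<in> basin N g B" using cover by blast
    obtain b where b: "b \<in> B" "g.codes (\<lambda>_. 1) b"
      by (rule g.pos_word_limit[OF g.const_one_pos_word])
    have "(\<lambda>k. word_map g (\<lambda>_. 1) k x) \<longlonglongrightarrow> p"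
      using b(1)[unfolded B] b(2) x(2) by (simp add: g.codes_def)
    then have "\<forall>\<^sub>F k in sequentially. word_map g (\<lambda>_. 1) k x \<in> {p}"
      using op by (intro topological_tendstoD) auto
    then obtain k where "word_map g (\<lambda>_. 1) k x = p"
      by (auto dest: eventually_happens)
    then show False using Yg[OF x(1), of k] by (simp add: Y_def)
  qed
  moreover have "Y \<noteq> {}"
    using f.A_nonempty f.A_subset_basin C p(1) by (auto simp: Y_def)
  ultimately obtain q where "Y = {q}"
    using f.backward_invariant_singleton[OF \<open>compact Y\<close> _ _ Yf] by blast
  then have "- {p} = {q}" by (simp add: Y_def)
  then have "p \<noteq> q" "UNIV = {p, q}" by auto
  then have "card (UNIV :: 'a set) = 2" by (simp only: card_2_iff) blast
  with X(2) show False by simp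
qed

section \<open>Passing to the dual by a change of sign\<close>

lemma hat_words_dual_iff: "\<iota> \<in> hat_words_dual N \<longleftrightarrow> (\<lambda>i. - \<iota> i) \<in> hat_words N"
proof -
  have "- \<iota> i \<noteq> - (- \<iota> (Suc i)) \<longleftrightarrow> \<iota> i \<noteq> - \<iota> (Suc i)" for i by auto
  then show ?thesis
    by (auto simp: hat_words_def hat_words_dual_def reduced_words_def)
qed

lemma word_shift_uminus: "(\<lambda>i. - word_shift n \<iota> i) = word_shift (- n) (\<lambda>i. - \<iota> i)"
  by (auto simp: word_shift_def fun_eq_iff split: nat.split)

text \<open>Makes the dual half of the theorem an instance of results about
  \<open>coding_map\<close> for the system \<open>dual f\<close>.\<close>

lemma (in homeo_ifs) coding_map_dual_eq:
  assumes "\<iota> \<in> hat_words_dual N"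
  shows "coding_map_dual N f A \<iota> = coding_map N (dual f) (dual_repeller N f A) (\<lambda>i. - \<iota> i)"
proof -
  have "\<And>i. \<iota> i \<in> pos_letters N \<union> neg_letters N"
    using assms by (auto simp: hat_words_dual_def reduced_words_def)
  from word_map_dual[OF this] show ?thesis
    by (simp add: coding_map_dual_def coding_map_def lim_on_def)
qed

theorem corollary5p8:
  fixes f :: "nat \<Rightarrow> 'a::complete_space \<Rightarrow> 'a" and N :: nat and A :: "'a set"
  assumes "ifs N f"
    and "attractor N f A"
    and "point_fibred N f A"
    and "interior A \<noteq> {}"
  shows
    "(contractive N f \<longrightarrow>
        coding_map N f A ` hat_words N = UNIV \<and>
        (\<forall>n\<in>neg_letters N.
           word_shift n ` hat_words N \<subseteq> hat_words N \<and>
           (\<forall>\<iota>\<in>hat_words N. coding_map N f A (word_shift n \<iota>) = letter_map f n (coding_map N f A \<iota>))))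
     \<and>
     (compact (UNIV :: 'a set) \<and>
      attractor N (dual f) (dual_repeller N f A) \<and>
      point_fibred N (dual f) (dual_repeller N f A) \<and>
      interior (dual_repeller N f A) \<noteq> {} \<longrightarrow>
        (card (UNIV :: 'a set) \<noteq> 2 \<longrightarrow>
           coding_map N f A ` hat_words N = UNIV \<and>
           coding_map_dual N f A ` hat_words_dual N = UNIV) \<and>
        (\<forall>n\<in>neg_letters N.
           word_shift n ` hat_words N \<subseteq> hat_words N \<and>
           (\<forall>\<iota>\<in>hat_words N. coding_map N f A (word_shift n \<iota>) = letter_map f n (coding_map N f A \<iota>))) \<and>
        (\<forall>n\<in>pos_letters N.
           word_shift n ` hat_words_dual N \<subseteq> hat_words_dual N \<and>
           (\<forall>\<iota>\<in>hat_words_dual N.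
              coding_map_dual N f A (word_shift n \<iota>) = letter_map f n (coding_map_dual N f A \<iota>))))"
proof (intro conjI impI ballI)
  interpret f: fibred_attractor N f A
    using assms by unfold_locales
  \<comment> \<open>Listed twice, as the conclusion occurs under both the contractive and the
    compact hypothesis.\<close>
  show "word_shift n ` hat_words N \<subseteq> hat_words N"
    "word_shift n ` hat_words N \<subseteq> hat_words N" if "n \<in> neg_letters N" for n
    using word_shift_hat_words[OF that] by blast+
  show "coding_map N f A (word_shift n \<iota>) = letter_map f n (coding_map N f A \<iota>)"
    "coding_map N f A (word_shift n \<iota>) = letter_map f n (coding_map N f A \<iota>)"
    if "n \<in> neg_letters N" "\<iota> \<in> hat_words N" for n \<iota>
    using f.coding_map_word_shift[OF that] by blast+
  show "coding_map N f A ` hat_words N = UNIV" if "contractive N f"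
    using f.basin_subset_coding_image[OF assms(4)] f.basin_contractive[OF that] by blast
  show "word_shift n ` hat_words_dual N \<subseteq> hat_words_dual N" if "n \<in> pos_letters N" for n
    using word_shift_hat_words[of "- n" N] that by (auto simp: hat_words_dual_iff word_shift_uminus)

  let ?R = "dual_repeller N f A"
  assume "compact (UNIV :: 'a set) \<and> attractor N (dual f) ?R \<and> point_fibred N (dual f) ?R \<and>
    interior ?R \<noteq> {}"
  then have X: "compact (UNIV :: 'a set)" and int: "interior ?R \<noteq> {}"
    and R: "attractor N (dual f) ?R" "point_fibred N (dual f) ?R"
    by auto
  interpret g: fibred_attractor N "dual f" ?R
    using f.ifs_dual R by unfold_locales
  \<comment> \<open>The complement of the first basin is the dual repeller, which lies in its own
    basin under the dual system.\<close>
  have cover: "basin N f A \<union> basin N (dual f) ?R = UNIV"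
    using g.A_subset_basin by (auto simp: dual_repeller_def)
  show "coding_map N f A ` hat_words N = UNIV" if "card (UNIV :: 'a set) \<noteq> 2"
    using cover by (intro coding_map_surj[OF f.fibred_attractor_axioms g.fibred_attractor_axioms
          _ X that _ assms(4) int]) (auto simp: dual_def)
  show "coding_map_dual N f A ` hat_words_dual N = UNIV" if "card (UNIV :: 'a set) \<noteq> 2"
  proof -
    \<comment> \<open>The same result with the roles of the two systems exchanged;
      \<open>dual_dual\<close> identifies \<open>f n\<close> with the inverse of
      \<open>dual f n\<close>.\<close>
    have surj: "coding_map N (dual f) ?R ` hat_words N = UNIV"
      using cover f.dual_dual
      by (intro coding_map_surj[OF g.fibred_attractor_axioms f.fibred_attractor_axioms
            _ X that _ int assms(4)]) (auto simp: dual_def)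
    have "x \<in> coding_map_dual N f A ` hat_words_dual N" for x
    proof -
      obtain \<iota> where \<iota>: "\<iota> \<in> hat_words N" "x = coding_map N (dual f) ?R \<iota>"
        using surj by blast
      then have "(\<lambda>i. - \<iota> i) \<in> hat_words_dual N" by (simp add: hat_words_dual_iff)
      with \<iota>(2) f.coding_map_dual_eq[OF this, of A] show ?thesis
        by (intro image_eqI[of _ _ "\<lambda>i. - \<iota> i"]) auto
    qed
    then show ?thesis by blast
  qed
  show "coding_map_dual N f A (word_shift n \<iota>) = letter_map f n (coding_map_dual N f A \<iota>)"
    if n: "n \<in> pos_letters N" and \<iota>: "\<iota> \<in> hat_words_dual N" for n \<iota>
  proof -
    have "word_shift n \<iota> \<in> hat_words_dual N"
      using word_shift_hat_words[of "- n" N] n \<iota>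
      by (simp add: hat_words_dual_iff word_shift_uminus)
    then show ?thesis
      using g.coding_map_word_shift[of "- n" "\<lambda>i. - \<iota> i"] n \<iota> f.letter_map_dual[of n]
      by (simp add: f.coding_map_dual_eq word_shift_uminus hat_words_dual_iff)
  qed
qed

end
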